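(* Let $n$ and $k$ be integers with $k\ge 3$ and $3k-3\le n\le k^2-k+1$. Suppose that $\mathcal{F}\subset\binom{[n]}{k}$ is a family of $k$-element subsets of $[n]=\{1,\dots,n\}$ such that for all distinct $F,F'\in\mathcal{F}$ we have $|F\cap F'|\in\{0,2,3,\dots,k-1\}$ (i.e. no two distinct members intersect in exactly one element). Then \[|\mathcal{F}|\le\binom{n-2}{k-2}.\]
   Context: $\binom{[n]}{k}$ denotes the family of all $k$-element subsets of $[n]=\{1,2,\dots,n\}$. *)

theory Defs
  imports Main
begin

definition ksubsets :: "nat \<Rightarrow> nat \<Rightarrow> nat set set" where
  "ksubsets n k = {F. F \<subseteq> {1..n} \<and> card F = k}"

end

theory Submission
  imports Defs Complex_Main
begin

text \<open>
  The proof is Wilson's eigenvalue argument for \<open>2\<close>-intersecting families. With \<open>A\<^sub>i\<close> the matrix on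
  \<open>k\<close>-sets recording intersections of size \<open>i\<close>, and \<open>m = n - k\<close>, consider
  \<open>M = I + a (A\<^sub>1 + k A\<^sub>0) - b A\<^sub>0\<close> with \<open>1/a = (m - 1 choose k - 2)\<close> and
  \<open>b = (k - 1) / (m - 2 choose k - 2)\<close>. The weights are chosen so that the eigenvalues of \<open>M\<close> on the
  harmonic components of degree \<open>1\<close> and \<open>2\<close> vanish; for \<open>n \<ge> 3k - 3\<close> those of higher degree are
  nonnegative, and that on the constants is \<open>n(n - 1) / (k(k - 1))\<close>. A family without singleton
  intersections does not see \<open>A\<^sub>1\<close>, and the remaining coefficient \<open>k a - b\<close> of \<open>A\<^sub>0\<close> is nonpositive
  exactly when \<open>n \<le> k\<^sup>2 - k + 1\<close>. So disjoint pairs may be allowed as well, and comparing the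
  quadratic form of \<open>M\<close> at the indicator function of the family with its constant component gives
  the bound.
\<close>

section \<open>Harmonic functions on the layers of a power set\<close>

definition layer :: "'a set \<Rightarrow> nat \<Rightarrow> 'a set set" where
  "layer V j = {S. S \<subseteq> V \<and> card S = j}"

lemma finite_layer: "finite V \<Longrightarrow> finite (layer V j)"
  unfolding layer_def by (rule finite_subset[of _ "Pow V"]) auto

lemma card_layer: "finite V \<Longrightarrow> card (layer V j) = card V choose j"
  unfolding layer_def by (rule n_subsets)

lemma layer_0: "finite V \<Longrightarrow> layer V 0 = {{}}"
  unfolding layer_def by (auto dest: finite_subset)

lemma layer_gt: "finite V \<Longrightarrow> card V < j \<Longrightarrow> layer V j = {}"
  unfolding layer_def by (auto dest: card_mono)

lemma layer_card: "finite V \<Longrightarrow> layer V (card V) = {V}"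
  unfolding layer_def by (auto dest: card_subset_eq)

lemma card_between:
  assumes "finite V" "S \<subseteq> V" "card S \<le> i"
  shows "card {U \<in> layer V i. S \<subseteq> U} = (card V - card S) choose (i - card S)"
proof -
  have fS: "finite S" using assms finite_subset by blast
  have "bij_betw (\<lambda>U. U - S) {U \<in> layer V i. S \<subseteq> U} (layer (V - S) (i - card S))"
  proof (rule bij_betw_byWitness[where f' = "\<lambda>U. U \<union> S"])
    show "(\<lambda>U. U \<union> S) ` layer (V - S) (i - card S) \<subseteq> {U \<in> layer V i. S \<subseteq> U}"
    proof clarsimp
      fix U assume U: "U \<in> layer (V - S) (i - card S)"
      then have "finite U" "U \<inter> S = {}"
        using assms(1) unfolding layer_def by (auto dest: finite_subset)
      then have "card (U \<union> S) = card U + card S"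
        using fS by (simp add: card_Un_disjoint)
      then show "U \<union> S \<in> layer V i"
        using U assms unfolding layer_def by auto
    qed
  qed (use fS in \<open>auto simp: layer_def card_Diff_subset\<close>)
  then have "card {U \<in> layer V i. S \<subseteq> U} = card (layer (V - S) (i - card S))"
    by (rule bij_betw_same_card)
  also have "\<dots> = (card V - card S) choose (i - card S)"
    using assms fS by (simp add: card_layer card_Diff_subset)
  finally show ?thesis .
qed

text \<open>Double counting: each \<open>i\<close>-set \<open>T\<close> is counted once for every
  \<open>j\<close>-set \<open>U\<close> between \<open>T\<close> and \<open>V\<close>.\<close>

lemma sum_sum_layer:
  fixes g :: "'a set \<Rightarrow> real"
  assumes "finite V" "i \<le> j"
  shows "(\<Sum>U \<in> layer V j. sum g (layer U i)) =
    real ((card V - i) choose (j - i)) * sum g (layer V i)"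
proof -
  have "layer U i = {T \<in> layer V i. T \<subseteq> U}" if "U \<in> layer V j" for U
    using that unfolding layer_def by auto
  then have "(\<Sum>U \<in> layer V j. sum g (layer U i)) =
      (\<Sum>U \<in> layer V j. \<Sum>T | T \<in> layer V i \<and> T \<subseteq> U. g T)"
    by simp
  also have "\<dots> = (\<Sum>T \<in> layer V i. \<Sum>U | U \<in> layer V j \<and> T \<subseteq> U. g T)"
    by (rule sum.swap_restrict) (simp_all add: finite_layer assms)
  also have "\<dots> = (\<Sum>T \<in> layer V i. real ((card V - i) choose (j - i)) * g T)"
  proof (rule sum.cong)
    fix T assume "T \<in> layer V i"
    then have "T \<subseteq> V" "card T = i" by (simp_all add: layer_def)
    then have "card {U \<in> layer V j. T \<subseteq> U} = (card V - i) choose (j - i)"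
      using card_between[of V T j] assms by simp
    then show "(\<Sum>U | U \<in> layer V j \<and> T \<subseteq> U. g T) = real ((card V - i) choose (j - i)) * g T"
      by simp
  qed simp
  finally show ?thesis by (simp add: sum_distrib_left)
qed

text \<open>Inclusion-exclusion: this writes the indicator of \<open>X = {}\<close> as a signed sum
  over subsets. Adding or removing a fixed element pairs off terms of opposite sign.\<close>

lemma sum_Pow_alternating:
  assumes "finite X"
  shows "(\<Sum>T \<in> Pow X. (-1::real) ^ card T) = (if X = {} then 1 else 0)"
proof (cases "X = {}")
  case False
  then obtain x Y where X: "X = insert x Y" "x \<notin> Y"
    by (metis Set.set_insert all_not_in_conv)
  then have fY: "finite Y" using assms by simp
  have "inj_on (insert x) (Pow Y)"
    using X(2) by (intro inj_onI) (metis PowD insert_ident subset_iff)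
  then have "(\<Sum>T \<in> insert x ` Pow Y. (-1::real) ^ card T) = (\<Sum>T \<in> Pow Y. (-1) ^ card (insert x T))"
    by (rule sum.reindex_cong) auto
  also have "\<dots> = - (\<Sum>T \<in> Pow Y. (-1) ^ card T)"
    unfolding sum_negf[symmetric]
  proof (rule sum.cong)
    fix T assume "T \<in> Pow Y"
    then have "finite T" "x \<notin> T" using X(2) fY finite_subset by auto
    then show "(- 1) ^ card (insert x T) = - ((- 1::real) ^ card T)" by simp
  qed simp
  finally show ?thesis
    using X fY unfolding X(1) Pow_insert by (subst sum.union_disjoint) auto
qed simp

text \<open>For \<open>j > 0\<close> this is the kernel of the map that sums a function on
  \<open>j\<close>-sets over all supersets of a given \<open>(j - 1)\<close>-set; for
  \<open>j = 0\<close> the condition is void. The form with all smaller \<open>T\<close> is the one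
  that inclusion-exclusion uses.\<close>

definition harmonic :: "'a set \<Rightarrow> nat \<Rightarrow> ('a set \<Rightarrow> real) \<Rightarrow> bool" where
  "harmonic V j g \<longleftrightarrow> (\<forall>T. T \<subseteq> V \<longrightarrow> card T < j \<longrightarrow> (\<Sum>S | S \<in> layer V j \<and> T \<subseteq> S. g S) = 0)"

lemma harmonicD:
  "harmonic V j g \<Longrightarrow> T \<subseteq> V \<Longrightarrow> card T < j \<Longrightarrow> (\<Sum>S | S \<in> layer V j \<and> T \<subseteq> S. g S) = 0"
  unfolding harmonic_def by blast

text \<open>Summing the hypothesis over all \<open>(j - 1)\<close>-sets \<open>U\<close> containing
  \<open>T\<close> counts each \<open>S\<close> once per element of \<open>S - T\<close>, that is
  \<open>j - card T\<close> times, a nonzero factor that cancels.\<close>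

lemma harmonicI:
  assumes "finite V"
    and *: "\<And>T. T \<in> layer V (j - 1) \<Longrightarrow> (\<Sum>S | S \<in> layer V j \<and> T \<subseteq> S. g S) = 0"
  shows "harmonic V j g"
  unfolding harmonic_def
proof (intro allI impI)
  fix T assume T: "T \<subseteq> V" "card T < j"
  have "0 = (\<Sum>U | U \<in> layer V (j - 1) \<and> T \<subseteq> U. \<Sum>S | S \<in> layer V j \<and> U \<subseteq> S. g S)"
    using * by simp
  also have "\<dots> = (\<Sum>U | U \<in> layer V (j - 1) \<and> T \<subseteq> U. \<Sum>S | S \<in> {S \<in> layer V j. T \<subseteq> S} \<and> U \<subseteq> S. g S)"
    by (intro sum.cong) auto
  also have "\<dots> = (\<Sum>S | S \<in> layer V j \<and> T \<subseteq> S.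
      \<Sum>U | U \<in> {U \<in> layer V (j - 1). T \<subseteq> U} \<and> U \<subseteq> S. g S)"
    by (rule sum.swap_restrict) (simp_all add: finite_layer assms)
  also have "\<dots> = (\<Sum>S | S \<in> layer V j \<and> T \<subseteq> S. real (j - card T) * g S)"
  proof (rule sum.cong, simp)
    fix S assume "S \<in> {S \<in> layer V j. T \<subseteq> S}"
    then have S: "S \<subseteq> V" "card S = j" "T \<subseteq> S" by (auto simp: layer_def)
    have "{U. U \<in> {U \<in> layer V (j - 1). T \<subseteq> U} \<and> U \<subseteq> S} = {U \<in> layer S (j - 1). T \<subseteq> U}"
      using S unfolding layer_def by auto
    moreover have "card {U \<in> layer S (j - 1). T \<subseteq> U} = (j - card T) choose (j - 1 - card T)"
      using S T assms(1) by (subst card_between) (auto dest: finite_subset)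
    moreover have "(j - card T) choose (j - 1 - card T) = j - card T"
    proof -
      have "(j - card T) choose (j - 1 - card T) = (j - card T) choose 1"
        using T(2) by (subst binomial_symmetric) auto
      then show ?thesis by simp
    qed
    ultimately show "(\<Sum>U | U \<in> {U \<in> layer V (j - 1). T \<subseteq> U} \<and> U \<subseteq> S. g S) = real (j - card T) * g S"
      by simp
  qed
  finally show "(\<Sum>S | S \<in> layer V j \<and> T \<subseteq> S. g S) = 0"
    using T(2) by (simp add: sum_distrib_left[symmetric])
qed

text \<open>Gram--Schmidt for an arbitrary finite family, which may be linearly dependent.\<close>

lemma ex_orthogonal_residual:
  fixes f :: "'x \<Rightarrow> real" and u :: "'i \<Rightarrow> 'x \<Rightarrow> real"
  assumes "finite I" "finite X"
  shows "\<exists>c. \<forall>i\<in>I. (\<Sum>x\<in>X. (f x - (\<Sum>l\<in>I. c l * u l x)) * u i x) = 0"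
  using assms(1)
proof (induction I arbitrary: f rule: finite_induct)
  case empty
  then show ?case by simp
next
  case (insert a I)
  obtain c where c: "\<forall>i\<in>I. (\<Sum>x\<in>X. (f x - (\<Sum>l\<in>I. c l * u l x)) * u i x) = 0"
    using insert.IH by blast
  obtain d where d: "\<forall>i\<in>I. (\<Sum>x\<in>X. (u a x - (\<Sum>l\<in>I. d l * u l x)) * u i x) = 0"
    using insert.IH by blast
  define r where "r x = f x - (\<Sum>l\<in>I. c l * u l x)" for x
  define v where "v x = u a x - (\<Sum>l\<in>I. d l * u l x)" for x
  have rI: "(\<Sum>x\<in>X. r x * u i x) = 0" and vI: "(\<Sum>x\<in>X. v x * u i x) = 0" if "i \<in> I" for i
    using c d that by (auto simp: r_def v_def)
  \<comment> \<open>If \<open>v\<close> vanishes on \<open>X\<close>, so that \<open>u a\<close>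
    depends on the other functions there, division by zero gives \<open>t = 0\<close>; any value
    would do.\<close>
  define t where "t = (\<Sum>x\<in>X. r x * v x) / (\<Sum>x\<in>X. v x * v x)"
  have t: "(\<Sum>x\<in>X. (r x - t * v x) * v x) = 0"
  proof (cases "(\<Sum>x\<in>X. v x * v x) = 0")
    case True
    then have "\<forall>x\<in>X. v x = 0" using assms(2) by (simp add: sum_nonneg_eq_0_iff)
    then show ?thesis by simp
  next
    case False
    have "(\<Sum>x\<in>X. (r x - t * v x) * v x) = (\<Sum>x\<in>X. r x * v x) - t * (\<Sum>x\<in>X. v x * v x)"
      by (simp add: left_diff_distrib sum_subtractf mult.assoc sum_distrib_left)
    then show ?thesis
      using False by (simp add: t_def)
  qed
  define e where "e l = (if l = a then t else c l - t * d l)" for l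
  have res: "f x - (\<Sum>l\<in>insert a I. e l * u l x) = r x - t * v x" for x
  proof -
    have "(\<Sum>l\<in>I. e l * u l x) = (\<Sum>l\<in>I. c l * u l x - t * (d l * u l x))"
      using insert.hyps(2) by (intro sum.cong) (auto simp: e_def algebra_simps)
    then show ?thesis
      using insert.hyps
      by (simp add: r_def v_def e_def sum_subtractf sum_distrib_left[symmetric] algebra_simps)
  qed
  have I0: "(\<Sum>x\<in>X. (r x - t * v x) * u i x) = 0" if "i \<in> I" for i
    using rI[OF that] vI[OF that]
    by (simp add: left_diff_distrib sum_subtractf mult.assoc sum_distrib_left[symmetric])
  \<comment> \<open>\<open>u a\<close> is \<open>v\<close> plus a combination of the
    \<open>u l\<close> with \<open>l \<in> I\<close>, and the new residual is orthogonal to all of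
    these.\<close>
  have "(\<Sum>x\<in>X. (r x - t * v x) * u a x) =
      (\<Sum>x\<in>X. (r x - t * v x) * v x + (\<Sum>l\<in>I. d l * ((r x - t * v x) * u l x)))"
  proof (rule sum.cong, simp)
    fix x
    have "(\<Sum>l\<in>I. d l * ((r x - t * v x) * u l x)) = (r x - t * v x) * (\<Sum>l\<in>I. d l * u l x)"
      by (simp add: sum_distrib_left mult_ac)
    then show "(r x - t * v x) * u a x = (r x - t * v x) * v x + (\<Sum>l\<in>I. d l * ((r x - t * v x) * u l x))"
      by (simp add: v_def distrib_left[symmetric])
  qed
  also have "\<dots> = (\<Sum>x\<in>X. (r x - t * v x) * v x) + (\<Sum>l\<in>I. \<Sum>x\<in>X. d l * ((r x - t * v x) * u l x))"
    by (simp add: sum.distrib sum.swap[of _ X I])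
  also have "\<dots> = 0"
    using t I0 by (simp add: sum_distrib_left[symmetric])
  finally show ?case
    using I0 by (intro exI[of _ e]) (simp add: res)
qed

text \<open>
  The residual of \<open>f\<close> after projection to the span of the functions \<open>S \<mapsto> [T \<subseteq> S]\<close> with
  \<open>card T = j - 1\<close> is harmonic, and the coefficients of the projection are a function on the layer
  below.
\<close>

lemma ex_harmonic_decomposition:
  assumes "finite V"
  shows "\<exists>g. (\<forall>i\<le>j. harmonic V i (g i)) \<and> (\<forall>S\<in>layer V j. f S = (\<Sum>i\<le>j. sum (g i) (layer S i)))"
proof (induction j arbitrary: f)
  case 0
  have "harmonic V 0 f" by (simp add: harmonic_def)
  then show ?case
    by (intro exI[of _ "\<lambda>_. f"]) (simp add: layer_0 assms)
next
  case (Suc j)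
  define u where "u T S = (if T \<subseteq> S then 1 else 0 :: real)" for T S :: "'a set"
  obtain c where c: "\<forall>T\<in>layer V j.
      (\<Sum>S\<in>layer V (Suc j). (f S - (\<Sum>U\<in>layer V j. c U * u U S)) * u T S) = 0"
    using ex_orthogonal_residual[where I = "layer V j" and X = "layer V (Suc j)" and f = f and u = u,
        OF finite_layer[OF assms] finite_layer[OF assms]] by blast
  have cu: "(\<Sum>U\<in>layer V j. c U * u U S) = sum c (layer S j)" if "S \<in> layer V (Suc j)" for S
  proof -
    have "layer S j = {U \<in> layer V j. U \<subseteq> S}" using that by (auto simp: layer_def)
    moreover have "(\<Sum>U\<in>layer V j. c U * u U S) = (\<Sum>U\<in>layer V j. if U \<subseteq> S then c U else 0)"
      by (intro sum.cong) (auto simp: u_def)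
    ultimately show ?thesis
      using finite_layer[OF assms] by (simp add: sum.inter_filter)
  qed
  define r where "r S = f S - sum c (layer S j)" for S
  have "harmonic V (Suc j) r"
  proof (rule harmonicI[OF assms])
    fix T assume "T \<in> layer V (Suc j - 1)"
    then have "0 = (\<Sum>S\<in>layer V (Suc j). (f S - (\<Sum>U\<in>layer V j. c U * u U S)) * u T S)"
      using c by simp
    also have "\<dots> = (\<Sum>S\<in>layer V (Suc j). if T \<subseteq> S then r S else 0)"
      by (intro sum.cong) (auto simp: cu r_def u_def[of T])
    finally show "(\<Sum>S | S \<in> layer V (Suc j) \<and> T \<subseteq> S. r S) = 0"
      using finite_layer[OF assms] by (simp add: sum.inter_filter)
  qed
  obtain g where g: "\<forall>i\<le>j. harmonic V i (g i)"
    and cg: "\<forall>S\<in>layer V j. c S = (\<Sum>i\<le>j. sum (g i) (layer S i))"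
    using Suc.IH[of c] by blast
  \<comment> \<open>An \<open>i\<close>-subset of a \<open>(j + 1)\<close>-set lies in
    \<open>Suc j - i\<close> of its \<open>j\<close>-subsets, which is the factor picked up when
    \<open>c\<close> is expanded one layer below.\<close>
  define h where "h i = (if i = Suc j then r else (\<lambda>T. real (Suc j - i) * g i T))" for i
  have "harmonic V i (h i)" if "i \<le> Suc j" for i
    using that g \<open>harmonic V (Suc j) r\<close>
    by (auto simp: h_def harmonic_def sum_distrib_left[symmetric] le_Suc_eq)
  moreover have "f S = (\<Sum>i\<le>Suc j. sum (h i) (layer S i))" if S: "S \<in> layer V (Suc j)" for S
  proof -
    have SV: "S \<subseteq> V" "card S = Suc j" "finite S"
      using S assms by (auto simp: layer_def dest: finite_subset)
    have "sum c (layer S j) = (\<Sum>T\<in>layer S j. \<Sum>i\<le>j. sum (g i) (layer T i))"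
      using cg SV(1) by (intro sum.cong) (auto simp: layer_def)
    also have "\<dots> = (\<Sum>i\<le>j. \<Sum>T\<in>layer S j. sum (g i) (layer T i))"
      by (rule sum.swap)
    also have "\<dots> = (\<Sum>i\<le>j. sum (h i) (layer S i))"
    proof (rule sum.cong, simp)
      fix i assume "i \<in> {..j}"
      then have i: "i \<le> j" by simp
      have "(Suc j - i) choose (j - i) = Suc j - i"
        using i by (simp add: Suc_diff_le)
      then show "(\<Sum>T\<in>layer S j. sum (g i) (layer T i)) = sum (h i) (layer S i)"
        using i SV by (simp add: sum_sum_layer h_def sum_distrib_left)
    qed
    finally show ?thesis
      using SV layer_card[of S] by (simp add: h_def r_def)
  qed
  ultimately show ?case by blast
qed

text \<open>Inclusion-exclusion over \<open>T \<subseteq> H\<close>: sets smaller than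
  \<open>j\<close> contribute nothing by harmonicity, larger ones lie in no \<open>j\<close>-set,
  and those of size \<open>j\<close> contribute only \<open>S = T\<close>.\<close>

lemma harmonic_sum_disjoint:
  assumes "finite V" "harmonic V j g" "H \<subseteq> V"
  shows "(\<Sum>S | S \<in> layer V j \<and> S \<inter> H = {}. g S) = (-1) ^ j * sum g (layer H j)"
proof -
  have fH: "finite H" using assms finite_subset by blast
  have "(\<Sum>S | S \<in> layer V j \<and> S \<inter> H = {}. g S) =
      (\<Sum>S\<in>layer V j. g S * (\<Sum>T\<in>Pow (S \<inter> H). (-1) ^ card T))"
    using fH unfolding sum.inter_filter[OF finite_layer[OF assms(1)]]
    by (intro sum.cong) (simp_all add: sum_Pow_alternating del: Pow_Int_eq)
  also have "\<dots> = (\<Sum>S\<in>layer V j. \<Sum>T | T \<in> Pow H \<and> T \<subseteq> S. (-1) ^ card T * g S)"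
    unfolding sum_distrib_left
    by (intro sum.cong) (auto simp: mult.commute)
  also have "\<dots> = (\<Sum>T\<in>Pow H. \<Sum>S | S \<in> layer V j \<and> T \<subseteq> S. (-1) ^ card T * g S)"
    using assms(1) fH by (intro sum.swap_restrict) (simp_all add: finite_layer)
  also have "\<dots> = (\<Sum>T\<in>Pow H. if card T = j then (-1) ^ j * g T else 0)"
  proof (rule sum.cong, simp)
    fix T assume "T \<in> Pow H"
    then have T: "T \<subseteq> V" using assms by auto
    consider "card T < j" | "card T = j" | "card T > j" by linarith
    then show "(\<Sum>S | S \<in> layer V j \<and> T \<subseteq> S. (-1) ^ card T * g S) = (if card T = j then (-1) ^ j * g T else 0)"
    proof cases
      case 1
      then show ?thesis
        using harmonicD[OF assms(2) T] by (simp add: sum_distrib_left[symmetric])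
    next
      case 2
      have "S = T" if "S \<in> layer V j" "T \<subseteq> S" for S
        using that 2 card_subset_eq[of S T] finite_subset[OF _ assms(1), of S]
        by (simp add: layer_def)
      then have "{S. S \<in> layer V j \<and> T \<subseteq> S} = {T}"
        using 2 T by (auto simp: layer_def)
      then show ?thesis using 2 by simp
    next
      case 3
      have "{S. S \<in> layer V j \<and> T \<subseteq> S} = {}"
        using 3 assms(1) by (auto simp: layer_def) (metis card_mono finite_subset not_le)
      then show ?thesis using 3 by (simp only: sum.empty) simp
    qed
  qed
  also have "\<dots> = (-1) ^ j * sum g (layer H j)"
  proof -
    have "{T \<in> Pow H. card T = j} = layer H j" by (auto simp: layer_def)
    then show ?thesis
      using fH by (simp add: sum.inter_filter[symmetric] sum_distrib_left del: Pow_iff)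
  qed
  finally show ?thesis .
qed

text \<open>The \<open>k\<close>-sets disjoint from \<open>H\<close> form a layer of
  \<open>V - H\<close>, where double counting reduces to \<open>j\<close>-sets. For
  \<open>card H = k\<close> the factor is the Kneser graph eigenvalue.\<close>

lemma harmonic_lift_sum_disjoint:
  assumes "finite V" "harmonic V j g" "H \<subseteq> V" "j \<le> k"
  shows "(\<Sum>F | F \<in> layer V k \<and> F \<inter> H = {}. sum g (layer F j)) =
    (-1) ^ j * real ((card V - card H - j) choose (k - j)) * sum g (layer H j)"
proof -
  have "{F. F \<in> layer V k \<and> F \<inter> H = {}} = layer (V - H) k"
       "{S. S \<in> layer V j \<and> S \<inter> H = {}} = layer (V - H) j"
    by (auto simp: layer_def)
  then show ?thesis
    using sum_sum_layer[of "V - H" j k g] harmonic_sum_disjoint[OF assms(1-3)] assms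
    by (simp add: card_Diff_subset finite_subset)
qed

text \<open>The condition \<open>T \<subseteq> F\<close> becomes a signed sum over
  \<open>R \<subseteq> T\<close> disjoint from \<open>F\<close>. Each \<open>R\<close> has fewer
  than \<open>j\<close> elements, so the previous formula gives a sum over an empty layer.\<close>

lemma harmonic_lift_sum_superset:
  assumes "finite V" "harmonic V j g" "T \<subseteq> V" "card T < j" "j \<le> k"
  shows "(\<Sum>F | F \<in> layer V k \<and> T \<subseteq> F. sum g (layer F j)) = 0"
proof -
  have fT: "finite T" using assms finite_subset by blast
  have "(\<Sum>F | F \<in> layer V k \<and> T \<subseteq> F. sum g (layer F j)) =
      (\<Sum>F\<in>layer V k. sum g (layer F j) * (\<Sum>R\<in>Pow (T - F). (-1) ^ card R))"
    using assms(1) fT unfolding sum.inter_filter[OF finite_layer[OF assms(1)]]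
    by (intro sum.cong) (auto simp: sum_Pow_alternating)
  also have "\<dots> = (\<Sum>F\<in>layer V k. \<Sum>R | R \<in> Pow T \<and> F \<inter> R = {}. (-1) ^ card R * sum g (layer F j))"
    by (subst sum_distrib_left, intro sum.cong) (auto simp: mult.commute)
  also have "\<dots> = (\<Sum>R\<in>Pow T. \<Sum>F | F \<in> layer V k \<and> F \<inter> R = {}. (-1) ^ card R * sum g (layer F j))"
    using assms(1) fT by (intro sum.swap_restrict) (simp_all add: finite_layer)
  also have "\<dots> = 0"
  proof (rule sum.neutral, rule ballI)
    fix R assume "R \<in> Pow T"
    then have "R \<subseteq> V" "finite R" "card R < j"
      using assms(3,4) fT by (auto intro: finite_subset card_mono[OF fT] le_less_trans)
    then show "(\<Sum>F | F \<in> layer V k \<and> F \<inter> R = {}. (-1) ^ card R * sum g (layer F j)) = 0"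
      using harmonic_lift_sum_disjoint[OF assms(1,2) _ assms(5), of R]
      by (simp add: sum_distrib_left[symmetric] layer_gt)
  qed
  finally show ?thesis .
qed

lemma harmonic_lift_orthogonal:
  assumes "finite V" "harmonic V j h" "i < j" "j \<le> k"
  shows "(\<Sum>F\<in>layer V k. sum g (layer F i) * sum h (layer F j)) = 0"
proof -
  have "(\<Sum>F\<in>layer V k. sum g (layer F i) * sum h (layer F j)) =
      (\<Sum>F\<in>layer V k. \<Sum>T | T \<in> layer V i \<and> T \<subseteq> F. g T * sum h (layer F j))"
    unfolding sum_distrib_right by (intro sum.cong) (auto simp: layer_def)
  also have "\<dots> = (\<Sum>T\<in>layer V i. \<Sum>F | F \<in> layer V k \<and> T \<subseteq> F. g T * sum h (layer F j))"
    using assms(1) by (intro sum.swap_restrict) (simp_all add: finite_layer)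
  also have "\<dots> = 0"
  proof (rule sum.neutral, rule ballI)
    fix T assume "T \<in> layer V i"
    then have "T \<subseteq> V" "card T < j" using assms(3) by (simp_all add: layer_def)
    then show "(\<Sum>F | F \<in> layer V k \<and> T \<subseteq> F. g T * sum h (layer F j)) = 0"
      using assms by (simp add: sum_distrib_left[symmetric] harmonic_lift_sum_superset)
  qed
  finally show ?thesis .
qed

section \<open>Wilson's matrix and its eigenvalues\<close>

text \<open>A \<open>j\<close>-set \<open>T\<close> survives the removal of \<open>x\<close> exactly
  for \<open>x \<in> F - T\<close>. This is the source of the factor \<open>k - j\<close> in the
  eigenvalue of B.\<close>

lemma sum_layer_remove:
  fixes g :: "'a set \<Rightarrow> real"
  assumes "finite F"
  shows "(\<Sum>x\<in>F. sum g (layer (F - {x}) j)) = real (card F - j) * sum g (layer F j)"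
proof -
  have "layer (F - {x}) j = {T. T \<in> layer F j \<and> x \<notin> T}" for x
    by (auto simp: layer_def)
  then have "(\<Sum>x\<in>F. sum g (layer (F - {x}) j)) = (\<Sum>x\<in>F. \<Sum>T | T \<in> layer F j \<and> x \<notin> T. g T)"
    by simp
  also have "\<dots> = (\<Sum>T\<in>layer F j. \<Sum>x | x \<in> F \<and> x \<notin> T. g T)"
    using assms by (intro sum.swap_restrict) (simp_all add: finite_layer)
  also have "\<dots> = (\<Sum>T\<in>layer F j. real (card F - j) * g T)"
  proof (rule sum.cong, simp)
    fix T assume "T \<in> layer F j"
    then have T: "T \<subseteq> F" "card T = j" by (simp_all add: layer_def)
    have "{x. x \<in> F \<and> x \<notin> T} = F - T" by auto
    then have "card {x. x \<in> F \<and> x \<notin> T} = card F - j"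
      using T assms by (simp add: card_Diff_subset finite_subset)
    then show "(\<Sum>x | x \<in> F \<and> x \<notin> T. g T) = real (card F - j) * g T" by simp
  qed
  finally show ?thesis by (simp add: sum_distrib_left)
qed

text \<open>
  Eigenvalue of \<open>I + a B - b A\<close> on the lifts of harmonic functions of degree \<open>j\<close>, where
  \<open>A(F, F') = [F \<inter> F' = {}]\<close> and \<open>B(F, F')\<close> counts the \<open>(k - 1)\<close>-subsets of \<open>F\<close> that are disjoint
  from \<open>F'\<close>; here \<open>m = card V - k\<close>.
\<close>

definition eigenvalue :: "real \<Rightarrow> real \<Rightarrow> nat \<Rightarrow> nat \<Rightarrow> nat \<Rightarrow> real" where
  "eigenvalue a b m k j = 1 + (-1) ^ j *
     (a * (real (k - j) * real ((m + 1 - j) choose (k - j))) - b * real ((m - j) choose (k - j)))"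

text \<open>The lifts are eigenvectors, and those of different degrees are orthogonal, so the form
  has no cross terms. The sum over \<open>x\<close> is B = A_1 + k A_0: the set
  \<open>F - {x}\<close> misses \<open>F'\<close> for \<open>k\<close>, one or no \<open>x\<close>,
  according as \<open>F\<close> and \<open>F'\<close> share zero, one or more elements.\<close>

lemma wilson_quadratic_form:
  fixes f :: "'a set \<Rightarrow> real"
  assumes V: "finite V" "card V = m + k"
    and g: "\<And>j. j \<le> k \<Longrightarrow> harmonic V j (g j)"
    and f: "\<And>F. F \<in> layer V k \<Longrightarrow> f F = (\<Sum>j\<le>k. sum (g j) (layer F j))"
  shows "(\<Sum>F\<in>layer V k. f F * (f F
      + a * (\<Sum>x\<in>F. \<Sum>F' | F' \<in> layer V k \<and> F' \<inter> (F - {x}) = {}. f F')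
      - b * (\<Sum>F' | F' \<in> layer V k \<and> F' \<inter> F = {}. f F'))) =
    (\<Sum>j\<le>k. eigenvalue a b m k j * (\<Sum>F\<in>layer V k. (sum (g j) (layer F j))\<^sup>2))"
proof -
  define \<phi> where "\<phi> j F = sum (g j) (layer F j)" for j F
  have orth: "(\<Sum>F\<in>layer V k. \<phi> i F * \<phi> j F) = 0" if "i \<le> k" "j \<le> k" "i \<noteq> j" for i j
  proof (cases "i < j")
    case True
    then show ?thesis
      unfolding \<phi>_def using V g that by (intro harmonic_lift_orthogonal) auto
  next
    case False
    then have "(\<Sum>F\<in>layer V k. \<phi> j F * \<phi> i F) = 0"
      unfolding \<phi>_def using V g that by (intro harmonic_lift_orthogonal) auto
    then show ?thesis by (simp add: mult.commute)
  qed
  have disj: "(\<Sum>F' | F' \<in> layer V k \<and> F' \<inter> H = {}. f F') =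
      (\<Sum>j\<le>k. (-1) ^ j * real ((card V - card H - j) choose (k - j)) * \<phi> j H)" if "H \<subseteq> V" for H
  proof -
    have "(\<Sum>F' | F' \<in> layer V k \<and> F' \<inter> H = {}. f F') =
        (\<Sum>F' | F' \<in> layer V k \<and> F' \<inter> H = {}. \<Sum>j\<le>k. \<phi> j F')"
      using f by (intro sum.cong) (simp_all add: \<phi>_def)
    also have "\<dots> = (\<Sum>j\<le>k. \<Sum>F' | F' \<in> layer V k \<and> F' \<inter> H = {}. \<phi> j F')"
      by (rule sum.swap)
    also have "\<dots> = (\<Sum>j\<le>k. (-1) ^ j * real ((card V - card H - j) choose (k - j)) * \<phi> j H)"
      unfolding \<phi>_def using V(1) g that by (intro sum.cong) (simp_all add: harmonic_lift_sum_disjoint)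
    finally show ?thesis .
  qed
  have Mf: "f F + a * (\<Sum>x\<in>F. \<Sum>F' | F' \<in> layer V k \<and> F' \<inter> (F - {x}) = {}. f F')
      - b * (\<Sum>F' | F' \<in> layer V k \<and> F' \<inter> F = {}. f F') =
      (\<Sum>j\<le>k. eigenvalue a b m k j * \<phi> j F)" if F: "F \<in> layer V k" for F
  proof -
    have FV: "F \<subseteq> V" "card F = k" "finite F"
      using F V(1) by (auto simp: layer_def dest: finite_subset)
    have "(\<Sum>x\<in>F. \<Sum>F' | F' \<in> layer V k \<and> F' \<inter> (F - {x}) = {}. f F') =
        (\<Sum>x\<in>F. \<Sum>j\<le>k. (-1) ^ j * real ((m + 1 - j) choose (k - j)) * \<phi> j (F - {x}))"
    proof (rule sum.cong, simp)
      fix x assume x: "x \<in> F"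
      then have "k \<ge> 1" using FV by (metis One_nat_def Suc_leI card_gt_0_iff empty_iff)
      \<comment> \<open>\<open>F - {x}\<close> has \<open>k - 1\<close> elements, hence
        \<open>m + 1\<close> in the binomial coefficient of B against \<open>m\<close> in that of
        A.\<close>
      then have "card V - card (F - {x}) = m + 1"
        using x FV V(2) by simp
      moreover have "F - {x} \<subseteq> V" using FV by auto
      ultimately show "(\<Sum>F' | F' \<in> layer V k \<and> F' \<inter> (F - {x}) = {}. f F') =
          (\<Sum>j\<le>k. (-1) ^ j * real ((m + 1 - j) choose (k - j)) * \<phi> j (F - {x}))"
        by (simp only: disj)
    qed
    also have "\<dots> = (\<Sum>j\<le>k. \<Sum>x\<in>F. (-1) ^ j * real ((m + 1 - j) choose (k - j)) * \<phi> j (F - {x}))"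
      by (rule sum.swap)
    also have "\<dots> = (\<Sum>j\<le>k. (-1) ^ j * real ((m + 1 - j) choose (k - j)) * (real (k - j) * \<phi> j F))"
      using sum_layer_remove[OF FV(3)] FV(2) by (simp add: \<phi>_def sum_distrib_left[symmetric])
    finally have B: "(\<Sum>x\<in>F. \<Sum>F' | F' \<in> layer V k \<and> F' \<inter> (F - {x}) = {}. f F') = \<dots>" .
    have A: "(\<Sum>F' | F' \<in> layer V k \<and> F' \<inter> F = {}. f F') =
       (\<Sum>j\<le>k. (-1) ^ j * real ((m - j) choose (k - j)) * \<phi> j F)"
      using disj[OF FV(1)] FV(2) V(2) by simp
    have "f F = (\<Sum>j\<le>k. \<phi> j F)" using f[OF F] by (simp add: \<phi>_def)
    then show ?thesis
      unfolding A B by (simp add: sum_distrib_left sum.distrib[symmetric] sum_subtractf[symmetric]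
          eigenvalue_def algebra_simps)
  qed
  have "(\<Sum>F\<in>layer V k. f F * (f F
      + a * (\<Sum>x\<in>F. \<Sum>F' | F' \<in> layer V k \<and> F' \<inter> (F - {x}) = {}. f F')
      - b * (\<Sum>F' | F' \<in> layer V k \<and> F' \<inter> F = {}. f F'))) =
    (\<Sum>F\<in>layer V k. (\<Sum>i\<le>k. \<phi> i F) * (\<Sum>j\<le>k. eigenvalue a b m k j * \<phi> j F))"
  proof (rule sum.cong, simp)
    fix F assume F: "F \<in> layer V k"
    show "f F * (f F + a * (\<Sum>x\<in>F. \<Sum>F' | F' \<in> layer V k \<and> F' \<inter> (F - {x}) = {}. f F')
        - b * (\<Sum>F' | F' \<in> layer V k \<and> F' \<inter> F = {}. f F')) =
        (\<Sum>i\<le>k. \<phi> i F) * (\<Sum>j\<le>k. eigenvalue a b m k j * \<phi> j F)"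
      unfolding Mf[OF F] by (simp add: f[OF F] \<phi>_def)
  qed
  also have "\<dots> = (\<Sum>F\<in>layer V k. \<Sum>j\<le>k. \<Sum>i\<le>k. eigenvalue a b m k j * (\<phi> i F * \<phi> j F))"
  proof (rule sum.cong, simp)
    fix F
    have "(\<Sum>i\<le>k. \<phi> i F) * (\<Sum>j\<le>k. eigenvalue a b m k j * \<phi> j F) =
        (\<Sum>i\<le>k. \<Sum>j\<le>k. eigenvalue a b m k j * (\<phi> i F * \<phi> j F))"
      by (simp only: sum_product mult_ac)
    also have "\<dots> = (\<Sum>j\<le>k. \<Sum>i\<le>k. eigenvalue a b m k j * (\<phi> i F * \<phi> j F))"
      by (rule sum.swap)
    finally show "(\<Sum>i\<le>k. \<phi> i F) * (\<Sum>j\<le>k. eigenvalue a b m k j * \<phi> j F) = \<dots>" .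
  qed
  also have "\<dots> = (\<Sum>j\<le>k. \<Sum>F\<in>layer V k. \<Sum>i\<le>k. eigenvalue a b m k j * (\<phi> i F * \<phi> j F))"
    by (rule sum.swap)
  also have "\<dots> = (\<Sum>j\<le>k. eigenvalue a b m k j * (\<Sum>F\<in>layer V k. (\<phi> j F)\<^sup>2))"
  proof (rule sum.cong, simp)
    fix j assume j: "j \<in> {..k}"
    have "(\<Sum>F\<in>layer V k. \<Sum>i\<le>k. eigenvalue a b m k j * (\<phi> i F * \<phi> j F)) =
        (\<Sum>i\<le>k. eigenvalue a b m k j * (\<Sum>F\<in>layer V k. \<phi> i F * \<phi> j F))"
      by (subst sum.swap) (simp add: sum_distrib_left)
    also have "\<dots> = (\<Sum>i\<in>{..k}. if i = j then eigenvalue a b m k j * (\<Sum>F\<in>layer V k. (\<phi> j F)\<^sup>2) else 0)"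
      using j orth by (intro sum.cong) (auto simp: power2_eq_square)
    also have "\<dots> = eigenvalue a b m k j * (\<Sum>F\<in>layer V k. (\<phi> j F)\<^sup>2)"
      using j by simp
    finally show "(\<Sum>F\<in>layer V k. \<Sum>i\<le>k. eigenvalue a b m k j * (\<phi> i F * \<phi> j F)) =
        eigenvalue a b m k j * (\<Sum>F\<in>layer V k. (\<phi> j F)\<^sup>2)" .
  qed
  finally show ?thesis by (simp add: \<phi>_def)
qed

section \<open>Signs of the eigenvalues for Wilson's weights, with m = n - k\<close>

context
  fixes m k :: nat
  assumes k: "k \<ge> 3" and m: "m + 3 \<ge> 2 * k"
begin

private abbreviation (input) R :: "nat \<Rightarrow> real" where
  "R j \<equiv> real ((m - j) choose (k - j))"

text \<open>\<open>R j * C j / ((m - 1) * R 2)\<close> is the deviation of the eigenvalue from 1, up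
  to the sign \<open>(-1) ^ j\<close>.\<close>

private abbreviation (input) C :: "nat \<Rightarrow> real" where
  "C j \<equiv> (real k - 1) * (real m - 1) - (real k - real j) * (real m + 1 - real j)"

lemma binomial_diff_Suc:
  assumes "j < k"
  shows "(real k - real j) * R j = (real m - real j) * R (Suc j)"
proof -
  have "(k - j) * ((m - j) choose (k - j)) = (m - j) * ((m - Suc j) choose (k - Suc j))"
    using times_binomial_minus1_eq[of "k - j" "m - j"] assms by simp
  then have "real (k - j) * R j = real (m - j) * R (Suc j)"
    by (metis of_nat_mult)
  moreover have "j \<le> m" using assms k m by linarith
  ultimately show ?thesis using assms by (simp add: of_nat_diff)
qed

lemma C_nonneg:
  assumes "2 \<le> j" "j \<le> k"
  shows "0 \<le> C j"
proof -
  have "(real k - real j) * (real m + 1 - real j) \<le> (real k - 1) * (real m - 1)"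
    using assms k m by (intro mult_mono) linarith+
  then show ?thesis by simp
qed

text \<open>
  Up to the factor \<open>(m - 1) R 2\<close>, the product \<open>R j * C j\<close> is what an even \<open>j\<close> subtracts from \<open>1\<close>. It
  decreases in \<open>j\<close>, and the case \<open>j = 4\<close> is an equality for \<open>m = 2k - 3\<close>.
\<close>

lemma R_C_le:
  "4 \<le> j \<Longrightarrow> j \<le> k \<Longrightarrow> R j * C j \<le> (real m - 1) * R 2"
proof (induction j rule: dec_induct)
  case base
  have "(real k - 3) * R 3 = (real m - 3) * R 4" "(real k - 2) * R 2 = (real m - 2) * R 3"
    using binomial_diff_Suc[of 3] binomial_diff_Suc[of 2] base by (simp_all add: numeral_eq_Suc)
  then have R4: "(real m - 2) * (real m - 3) * R 4 = (real k - 2) * (real k - 3) * R 2"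
    by algebra
  have "(real k - 2) * (real k - 3) * C 4 \<le> (real m - 1) * (real m - 2) * (real m - 3)"
  proof -
    \<comment> \<open>\<open>s\<close> measures the excess of \<open>m\<close> over
      \<open>2 * k - 3\<close>. In \<open>y\<close> and \<open>s\<close> the difference of the two
      sides has nonnegative coefficients, and it vanishes at \<open>s = 0\<close>.\<close>
    define y s where "y = k - 4" and "s = m + 3 - 2 * k"
    have "real k = real y + 4" "real m = 2 * real y + 5 + real s"
      using base m by (simp_all add: y_def s_def of_nat_diff)
    moreover have "0 \<le> real s ^ 3 + (real s)\<^sup>2 * (6 * real y + 9) + real s * (9 * (real y)\<^sup>2 + 27 * real y + 20)"
      by simp
    ultimately show ?thesis by (simp add: algebra_simps power2_eq_square power3_eq_cube)
  qed
  then have "((real k - 2) * (real k - 3) * C 4) * R 2 \<le> ((real m - 1) * (real m - 2) * (real m - 3)) * R 2"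
    by (rule mult_right_mono) simp
  moreover have "((real m - 2) * (real m - 3)) * (R 4 * C 4) = ((real k - 2) * (real k - 3) * C 4) * R 2"
    using R4 by algebra
  ultimately have "((real m - 2) * (real m - 3)) * (R 4 * C 4) \<le> ((real m - 2) * (real m - 3)) * ((real m - 1) * R 2)"
    by (simp only: mult_ac)
  moreover have "0 < (real m - 2) * (real m - 3)"
    using base m by (intro mult_pos_pos) linarith+
  ultimately show ?case by (rule mult_left_le_imp_le)
next
  case (step j)
  then have j: "4 \<le> j" "j < k" by simp_all
  \<comment> \<open>A doubling of \<open>C\<close> is affordable:
    \<open>R (Suc j) / R j = (k - j) / (m - j)\<close> is at most 1/2, since
    \<open>2 * k \<le> m + 3 \<le> m + j\<close>.\<close>
  have C2: "C (Suc j) \<le> 2 * C j"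
  proof -
    define p q t where "p = k - j" and "q = m - j" and "t = j - 4"
    have "real k = real j + real p" "real m = real j + real q" "real j = real t + 4"
      using j k m by (simp_all add: p_def q_def t_def of_nat_diff)
    moreover have "0 \<le> (real t + 3)\<^sup>2 + (real t + 1) * real p + (real t + 2) * real q"
      by simp
    ultimately show ?thesis by (simp add: algebra_simps power2_eq_square)
  qed
  have C0: "0 \<le> C j" using C_nonneg j by simp
  have pos: "0 < real m - real j" using j k m by simp
  have "(real m - real j) * (R (Suc j) * C (Suc j)) = (real k - real j) * R j * C (Suc j)"
    using binomial_diff_Suc[OF j(2)] by algebra
  also have "\<dots> \<le> (real k - real j) * R j * (2 * C j)"
    using j by (intro mult_left_mono[OF C2]) simp
  also have "\<dots> = (2 * (real k - real j)) * (R j * C j)"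
    by (simp only: mult_ac)
  also have "\<dots> \<le> (real m - real j) * (R j * C j)"
  proof (rule mult_right_mono[OF _ mult_nonneg_nonneg[OF of_nat_0_le_iff C0]])
    show "2 * (real k - real j) \<le> real m - real j"
      using j m of_nat_le_iff[of "2 * k" "m + j", where 'a = real] by simp
  qed
  finally have "R (Suc j) * C (Suc j) \<le> R j * C j"
    using pos by (rule mult_left_le_imp_le)
  also have "\<dots> \<le> (real m - 1) * R 2" using step.IH j(2) by (simp only: less_imp_le)
  finally show ?case .
qed

private abbreviation (input) wilson_eigenvalue :: "nat \<Rightarrow> real" where
  "wilson_eigenvalue j \<equiv>
    eigenvalue (1 / real ((m - 1) choose (k - 2))) ((real k - 1) / real ((m - 2) choose (k - 2))) m k j"

lemma R2_pos: "0 < R 2"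
  using k m by simp

text \<open>Expresses the binomial coefficient of B by that of A, so that \<open>R j\<close> becomes
  a common factor; \<open>i = 2\<close> rewrites the weight \<open>a\<close>.\<close>

lemma binomial_absorb_diff:
  assumes "i \<le> k"
  shows "(real m + 1 - real k) * real ((m + 1 - i) choose (k - i)) = (real m + 1 - real i) * R i"
proof -
  have "k \<le> m" using k m by linarith
  have "(m + 1 - i - (k - i)) * ((m + 1 - i) choose (k - i)) = (m + 1 - i) * ((m - i) choose (k - i))"
    using binomial_absorb_comp[of "m + 1 - i" "k - i"] assms \<open>k \<le> m\<close> by (simp add: Suc_diff_le)
  moreover have "m + 1 - i - (k - i) = m + 1 - k" using assms by simp
  ultimately have "real (m + 1 - k) * real ((m + 1 - i) choose (k - i)) = real (m + 1 - i) * R i"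
    by (metis of_nat_mult)
  then show ?thesis using assms \<open>k \<le> m\<close> by (simp add: of_nat_diff add.commute)
qed

lemma inverse_binomial_eq:
  "1 / real ((m - 1) choose (k - 2)) = (real m + 1 - real k) / ((real m - 1) * R 2)"
proof -
  have "k \<le> m" using k m by linarith
  then have "0 < real m - 1" using k by linarith
  have "m + 1 - 2 = m - 1" using k by simp
  then have "(real m + 1 - real k) * real ((m - 1) choose (k - 2)) = (real m - 1) * R 2"
    using binomial_absorb_diff[of 2] k by simp
  moreover have "real ((m - 1) choose (k - 2)) > 0" using \<open>k \<le> m\<close> k by simp
  ultimately show ?thesis using \<open>0 < real m - 1\<close> R2_pos by (simp add: field_simps)
qed

text \<open>Over the common denominator \<open>(m - 1) * R 2\<close> the claim reads
  \<open>k * (m + 1 - k) \<le> (k - 1) * (m - 1)\<close>, which rearranges to the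
  assumption.\<close>

lemma wilson_coefficient_le:
  assumes "m \<le> (k - 1)\<^sup>2"
  shows "real k * (1 / real ((m - 1) choose (k - 2))) \<le> (real k - 1) / real ((m - 2) choose (k - 2))"
proof -
  have m1: "0 < real m - 1" using k m by linarith
  have "real m \<le> real ((k - 1)\<^sup>2)" using assms by (simp only: of_nat_le_iff)
  also have "\<dots> = (real k - 1)\<^sup>2" using k by (simp add: of_nat_diff)
  finally have "real k * (real m + 1 - real k) \<le> (real k - 1) * (real m - 1)"
    by (simp add: power2_eq_square algebra_simps)
  then have "real k * (real m + 1 - real k) / ((real m - 1) * R 2)
      \<le> (real k - 1) * (real m - 1) / ((real m - 1) * R 2)"
    using m1 R2_pos by (intro divide_right_mono mult_nonneg_nonneg) simp_all
  then show ?thesis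
    unfolding inverse_binomial_eq using m1 by simp
qed

lemma wilson_eigenvalue_eq:
  assumes "j \<le> k"
  shows "wilson_eigenvalue j = 1 - (-1) ^ j * (R j * C j / ((real m - 1) * R 2))"
proof -
  have m1: "0 < real m - 1" using k m by linarith
  have b: "(real k - 1) / R 2 = (real k - 1) * (real m - 1) / ((real m - 1) * R 2)"
    using m1 by simp
  have "(real m + 1 - real k) / ((real m - 1) * R 2) * (real (k - j) * real ((m + 1 - j) choose (k - j))) =
      (real k - real j) * ((real m + 1 - real k) * real ((m + 1 - j) choose (k - j))) / ((real m - 1) * R 2)"
    using assms by (simp add: of_nat_diff)
  also have "\<dots> = (real k - real j) * ((real m + 1 - real j) * R j) / ((real m - 1) * R 2)"
    by (simp only: binomial_absorb_diff[OF assms])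
  finally have A: "(real m + 1 - real k) / ((real m - 1) * R 2) * (real (k - j) * real ((m + 1 - j) choose (k - j))) =
      (real k - real j) * ((real m + 1 - real j) * R j) / ((real m - 1) * R 2)" .
  have "(real k - real j) * ((real m + 1 - real j) * R j) - (real k - 1) * (real m - 1) * R j = - (R j * C j)"
    by algebra
  then show ?thesis
    unfolding eigenvalue_def inverse_binomial_eq b A
    by (simp only: times_divide_eq_left diff_divide_distrib[symmetric])
qed

text \<open>Two recursion steps reduce \<open>R 0\<close> to \<open>R 2\<close>. With n = m + k the
  value is the ratio of \<open>n choose k\<close> to \<open>(n - 2) choose (k - 2)\<close>, which
  produces the final bound.\<close>

lemma wilson_eigenvalue_0:
  "wilson_eigenvalue 0 = (real m + real k) * (real m + real k - 1) / (real k * (real k - 1))"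
proof -
  have R: "real k * R 0 = real m * R 1" "(real k - 1) * R 1 = (real m - 1) * R 2"
    using binomial_diff_Suc[of 0] binomial_diff_Suc[of 1] k by (simp_all add: numeral_eq_Suc)
  have m1: "0 < real m - 1" and k1: "0 < real k - 1" "0 < real k" using m k by linarith+
  have R2: "0 < R 2" by (rule R2_pos)
  have "real k * (real k - 1) * R 0 = real m * ((real m - 1) * R 2)" using R by algebra
  then have "R 0 / ((real m - 1) * R 2) = real m / (real k * (real k - 1))"
    using m1 k1 R2 by (simp add: field_simps)
  then have "R 0 * C 0 / ((real m - 1) * R 2) = real m / (real k * (real k - 1)) * C 0"
    by (simp only: times_divide_eq_left[symmetric])
  moreover have "wilson_eigenvalue 0 = 1 - (-1) ^ 0 * (R 0 * C 0 / ((real m - 1) * R 2))"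
    by (intro wilson_eigenvalue_eq) simp
  ultimately have "wilson_eigenvalue 0 = 1 - real m / (real k * (real k - 1)) * C 0"
    by (simp only: power_0 mult_1)
  also have "\<dots> = (real m + real k) * (real m + real k - 1) / (real k * (real k - 1))"
    using k1 by (simp add: divide_simps) algebra
  finally show ?thesis .
qed

text \<open>Degrees 1 and 2 give zero by the choice of weights. For odd \<open>j \<ge> 3\<close> a
  nonnegative term is added to 1; for even \<open>j \<ge> 4\<close> the subtracted term is at most 1
  by \<open>R_C_le\<close>.\<close>

lemma wilson_eigenvalue_nonneg:
  assumes "1 \<le> j" "j \<le> k"
  shows "0 \<le> wilson_eigenvalue j"
proof -
  have m1: "0 < real m - 1" using m k by linarith
  then have pos: "0 < (real m - 1) * R 2" using R2_pos by simp
  have "j = 1 \<or> odd j \<and> 2 \<le> j \<or> j = 2 \<or> even j \<and> 4 \<le> j"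
    using assms by presburger
  then consider "j = 1" | "odd j" "2 \<le> j" | "j = 2" | "even j" "4 \<le> j"
    by blast
  then show ?thesis
  proof cases
    case 1
    have "(real k - 1) * R 1 = (real m - 1) * R 2"
      using binomial_diff_Suc[of 1] k by (simp add: numeral_eq_Suc)
    moreover have "C 1 = - (real k - 1)" by (simp add: algebra_simps)
    ultimately have "R 1 * C 1 = - ((real m - 1) * R 2)" by algebra
    then have "R 1 * C 1 / ((real m - 1) * R 2) = - 1"
      using pos by (simp only: minus_divide_left[symmetric] divide_self)
    moreover have "wilson_eigenvalue 1 = 1 - (-1) ^ 1 * (R 1 * C 1 / ((real m - 1) * R 2))"
      using k by (intro wilson_eigenvalue_eq) simp
    ultimately have "wilson_eigenvalue 1 = 0" by (simp only:) simp
    then show ?thesis using 1 by simp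
  next
    case 2
    then have "0 \<le> R j * C j / ((real m - 1) * R 2)"
      using C_nonneg assms pos by (intro divide_nonneg_pos mult_nonneg_nonneg) simp_all
    then show ?thesis unfolding wilson_eigenvalue_eq[OF assms(2)] using 2 by simp
  next
    case 3
    have "C 2 = real m - 1" by (simp add: algebra_simps)
    then have "R 2 * C 2 / ((real m - 1) * R 2) = ((real m - 1) * R 2) / ((real m - 1) * R 2)"
      by (simp only: mult.commute)
    also have "\<dots> = 1" using pos by (intro divide_self) (rule less_imp_neq[symmetric])
    finally have "R 2 * C 2 / ((real m - 1) * R 2) = 1" .
    then show ?thesis unfolding wilson_eigenvalue_eq[OF assms(2)] unfolding 3 by (simp only:) simp
  next
    case 4
    then have "R j * C j / ((real m - 1) * R 2) \<le> 1"
      using R_C_le[OF 4(2) assms(2)] pos by (simp only: divide_le_eq_1_pos)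
    then show ?thesis unfolding wilson_eigenvalue_eq[OF assms(2)] using 4 by simp
  qed
qed

text \<open>Only the constant component of \<open>f\<close> is kept. If its value is c and N is the
  number of \<open>k\<close>-sets, then \<open>f\<close> sums to N c and the component has squared
  norm N c^2, which explains the factor N on the right.\<close>

lemma wilson_spectral_bound:
  fixes f :: "'a set \<Rightarrow> real"
  defines "a \<equiv> 1 / real ((m - 1) choose (k - 2))"
    and "b \<equiv> (real k - 1) / real ((m - 2) choose (k - 2))"
  assumes V: "finite V" "card V = m + k"
  shows "(real m + real k) * (real m + real k - 1) / (real k * (real k - 1)) * (sum f (layer V k))\<^sup>2
    \<le> real ((m + k) choose k) * (\<Sum>F\<in>layer V k. f F * (f F
      + a * (\<Sum>x\<in>F. \<Sum>F' | F' \<in> layer V k \<and> F' \<inter> (F - {x}) = {}. f F')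
      - b * (\<Sum>F' | F' \<in> layer V k \<and> F' \<inter> F = {}. f F')))"
    (is "?l0 * _ \<le> ?N * ?Q")
proof -
  obtain g where g: "\<forall>j\<le>k. harmonic V j (g j)"
    and f: "\<forall>F\<in>layer V k. f F = (\<Sum>j\<le>k. sum (g j) (layer F j))"
    using ex_harmonic_decomposition[OF V(1), of k f] by blast
  define q where "q j = (\<Sum>F\<in>layer V k. (sum (g j) (layer F j))\<^sup>2)" for j
  have g0: "sum (g 0) (layer F 0) = g 0 {}" if "F \<in> layer V k" for F
    using that V(1) finite_subset[of F V] by (auto simp: layer_def[of V] layer_0)
  have q0: "q 0 = ?N * (g 0 {})\<^sup>2"
    using V by (simp add: q_def g0 card_layer)
  have "sum f (layer V k) = (\<Sum>F\<in>layer V k. \<Sum>j\<le>k. sum (g j) (layer F j))"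
    using f by simp
  also have "\<dots> = (\<Sum>j\<le>k. \<Sum>F\<in>layer V k. sum (g j) (layer F j))"
    by (rule sum.swap)
  also have "\<dots> = (\<Sum>j\<in>{..k}. if j = 0 then ?N * g 0 {} else 0)"
  proof (rule sum.cong, simp)
    fix j assume j: "j \<in> {..k}"
    \<comment> \<open>Orthogonality to constants: the superset formula with
      \<open>T = {}\<close>.\<close>
    have "(\<Sum>F\<in>layer V k. sum (g j) (layer F j)) = 0" if "j \<noteq> 0"
      using harmonic_lift_sum_superset[of V j "g j" "{}" k] g j that V by simp
    then show "(\<Sum>F\<in>layer V k. sum (g j) (layer F j)) = (if j = 0 then ?N * g 0 {} else 0)"
      using V by (simp add: g0 card_layer)
  qed
  also have "\<dots> = ?N * g 0 {}" by simp
  finally have sum_f: "sum f (layer V k) = ?N * g 0 {}" .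
  have "?Q = (\<Sum>j\<le>k. wilson_eigenvalue j * q j)"
    unfolding q_def a_def b_def using g f by (intro wilson_quadratic_form V) simp_all
  moreover have "(\<Sum>j\<in>{0}. wilson_eigenvalue j * q j) \<le> (\<Sum>j\<le>k. wilson_eigenvalue j * q j)"
  proof (rule sum_mono2)
    fix j assume "j \<in> {..k} - {0}"
    then show "0 \<le> wilson_eigenvalue j * q j"
      using wilson_eigenvalue_nonneg[of j] by (intro mult_nonneg_nonneg) (auto simp: q_def sum_nonneg)
  qed auto
  ultimately have "?l0 * q 0 \<le> ?Q"
    using wilson_eigenvalue_0 by simp
  then have le: "?N * (?l0 * q 0) \<le> ?N * ?Q" by (rule mult_left_mono) simp
  have eq: "?N * (?l0 * q 0) = ?l0 * (sum f (layer V k))\<^sup>2"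
    unfolding q0 sum_f by (simp only: power2_eq_square mult_ac)
  show ?thesis using le unfolding eq .
qed

end

section \<open>Families without singleton intersections\<close>

text \<open>The left side is the entry B(F, F'); without singleton intersections only the part k A_0
  of B remains.\<close>

lemma card_nearly_disjoint:
  assumes "card F = k" "k \<ge> 3" "F \<inter> F' = {} \<or> card (F \<inter> F') \<ge> 2"
  shows "card {x \<in> F. F' \<inter> (F - {x}) = {}} = (if F' \<inter> F = {} then k else 0)"
proof (cases "F' \<inter> F = {}")
  case True
  then have "{x \<in> F. F' \<inter> (F - {x}) = {}} = F" by auto
  then show ?thesis using True assms(1) by simp
next
  case False
  then have *: "card (F \<inter> F') \<ge> 2" using assms(3) by auto
  have "F' \<inter> (F - {x}) \<noteq> {}" for x
  proof
    assume "F' \<inter> (F - {x}) = {}"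
    then have "F \<inter> F' \<subseteq> {x}" by auto
    then have "card (F \<inter> F') \<le> card {x}" by (intro card_mono) auto
    then show False using * by simp
  qed
  then show ?thesis using False by simp
qed

theorem theorem3:
  fixes n k :: nat and \<F> :: "nat set set"
  assumes "k \<ge> 3"
    and "3 * k - 3 \<le> n" and "n \<le> k\<^sup>2 - k + 1"
    and "\<F> \<subseteq> ksubsets n k"
    and "\<And>F F'. F \<in> \<F> \<Longrightarrow> F' \<in> \<F> \<Longrightarrow> F \<noteq> F' \<Longrightarrow> card (F \<inter> F') \<in> {0} \<union> {2..k - 1}"
  shows "card \<F> \<le> (n - 2) choose (k - 2)"
proof -
  define V where "V = {1..n}"
  define m where "m = n - k"
  define f where "f F = (if F \<in> \<F> then 1 else 0 :: real)" for F
  define a where "a = 1 / real ((m - 1) choose (k - 2))"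
  define b where "b = (real k - 1) / real ((m - 2) choose (k - 2))"
  have n: "n = m + k" and m3: "2 * k \<le> m + 3" using assms(1,2) by (auto simp: m_def)
  have V: "finite V" "card V = m + k" using n by (simp_all add: V_def)
  have F: "\<F> \<subseteq> layer V k" using assms(4) by (simp add: V_def layer_def ksubsets_def)
  then have finF: "finite \<F>" using finite_layer[OF V(1)] finite_subset by blast
  have sum_f: "(\<Sum>F | F \<in> layer V k \<and> P F. f F) = real (card {F \<in> \<F>. P F})" for P
  proof -
    have "(\<Sum>F | F \<in> layer V k \<and> P F. f F) = (\<Sum>F \<in> {F \<in> \<F>. P F}. f F)"
      using F finite_layer[OF V(1)] by (intro sum.mono_neutral_right) (auto simp: f_def)
    then show ?thesis by (simp add: f_def)
  qed
  have ab: "real k * a \<le> b"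
  proof -
    \<comment> \<open>\<open>k \<le> k\<^sup>2\<close> makes the natural subtraction in the
      hypothesis a true difference.\<close>
    have "n + k \<le> k\<^sup>2 + 1" using assms(3) self_le_power[of k 2] assms(1) by simp
    then have "m \<le> (k - 1)\<^sup>2"
      using n assms(1) by (cases k) (auto simp: power2_eq_square)
    then show ?thesis
      unfolding a_def b_def using wilson_coefficient_le[OF assms(1) m3] by blast
  qed
  \<comment> \<open>At a member \<open>F\<close> the matrix yields 1 plus \<open>k * a - b\<close>
    times the number of members disjoint from \<open>F\<close>, and that coefficient is
    nonpositive.\<close>
  have row: "f F + a * (\<Sum>x\<in>F. \<Sum>F' | F' \<in> layer V k \<and> F' \<inter> (F - {x}) = {}. f F')
      - b * (\<Sum>F' | F' \<in> layer V k \<and> F' \<inter> F = {}. f F') \<le> 1" if FF: "F \<in> \<F>" for F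
  proof -
    have Fk: "card F = k" "finite F"
      using FF F V(1) by (auto simp: layer_def dest: finite_subset)
    \<comment> \<open>The diagonal case \<open>F = F'\<close> is included; there the intersection
      has \<open>k \<ge> 3\<close> elements.\<close>
    have inter: "F \<inter> F' = {} \<or> card (F \<inter> F') \<ge> 2" if "F' \<in> \<F>" for F'
      using assms(5)[OF FF that] Fk assms(1) by (cases "F = F'") auto
    have "(\<Sum>x\<in>F. \<Sum>F' | F' \<in> layer V k \<and> F' \<inter> (F - {x}) = {}. f F') =
        (\<Sum>x\<in>F. \<Sum>F' | F' \<in> \<F> \<and> F' \<inter> (F - {x}) = {}. 1)"
      by (simp add: sum_f)
    also have "\<dots> = (\<Sum>F'\<in>\<F>. \<Sum>x | x \<in> F \<and> F' \<inter> (F - {x}) = {}. 1)"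
      by (rule sum.swap_restrict) (use Fk finF in auto)
    also have "\<dots> = (\<Sum>F'\<in>\<F>. if F' \<inter> F = {} then real k else 0)"
      using card_nearly_disjoint[OF Fk(1) assms(1) inter] by (intro sum.cong) simp_all
    also have "\<dots> = real k * real (card {F' \<in> \<F>. F' \<inter> F = {}})"
      using finF by (simp add: sum.inter_filter[symmetric])
    finally have "f F + a * (\<Sum>x\<in>F. \<Sum>F' | F' \<in> layer V k \<and> F' \<inter> (F - {x}) = {}. f F')
      - b * (\<Sum>F' | F' \<in> layer V k \<and> F' \<inter> F = {}. f F') =
      1 + (real k * a - b) * real (card {F' \<in> \<F>. F' \<inter> F = {}})"
      using FF unfolding sum_f by (simp add: f_def algebra_simps)
    moreover have "(real k * a - b) * real (card {F' \<in> \<F>. F' \<inter> F = {}}) \<le> 0"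
      using ab by (intro mult_nonpos_nonneg) simp_all
    ultimately show ?thesis by simp
  qed
  have "(\<Sum>F\<in>layer V k. f F * (f F
      + a * (\<Sum>x\<in>F. \<Sum>F' | F' \<in> layer V k \<and> F' \<inter> (F - {x}) = {}. f F')
      - b * (\<Sum>F' | F' \<in> layer V k \<and> F' \<inter> F = {}. f F'))) \<le> sum f (layer V k)" (is "?Q \<le> _")
  proof (rule sum_mono)
    fix F show "f F * (f F
      + a * (\<Sum>x\<in>F. \<Sum>F' | F' \<in> layer V k \<and> F' \<inter> (F - {x}) = {}. f F')
      - b * (\<Sum>F' | F' \<in> layer V k \<and> F' \<inter> F = {}. f F')) \<le> f F"
    proof (cases "F \<in> \<F>")
      case True
      then have "f F = 1" by (simp add: f_def)
      then show ?thesis using row[OF True] by simp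
    qed (simp add: f_def)
  qed
  also have card_F: "sum f (layer V k) = real (card \<F>)" using sum_f[of "\<lambda>_. True"] by simp
  finally have Q: "?Q \<le> real (card \<F>)" .
  have "real n * (real n - 1) / (real k * (real k - 1)) * (real (card \<F>))\<^sup>2 \<le> real (n choose k) * ?Q"
    using wilson_spectral_bound[OF assms(1) m3 V, of f] unfolding n card_F a_def b_def by simp
  also have "\<dots> \<le> real (n choose k) * real (card \<F>)"
    using Q by (rule mult_left_mono) simp
  \<comment> \<open>The factor is the eigenvalue on constants, so it cancels from both sides, as
    does one \<open>card \<F>\<close> when nonzero.\<close>
  also have "real (n choose k) =
      real n * (real n - 1) / (real k * (real k - 1)) * real ((n - 2) choose (k - 2))"
  proof -
    have "k * (n choose k) = n * ((n - 1) choose (k - 1))"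
      "(k - 1) * ((n - 1) choose (k - 1)) = (n - 1) * ((n - 2) choose (k - 2))"
      using times_binomial_minus1_eq[of k n] times_binomial_minus1_eq[of "k - 1" "n - 1"] assms(1)
      by (simp_all add: numeral_2_eq_2)
    then have "k * (k - 1) * (n choose k) = n * (n - 1) * ((n - 2) choose (k - 2))"
      by algebra
    then have "real k * real (k - 1) * real (n choose k) = real n * real (n - 1) * real ((n - 2) choose (k - 2))"
      by (metis of_nat_mult)
    then show ?thesis
      using assms(1) n by (simp add: of_nat_diff field_simps)
  qed
  finally have "(real n * (real n - 1) / (real k * (real k - 1)) * real (card \<F>)) * real (card \<F>) \<le>
     (real n * (real n - 1) / (real k * (real k - 1)) * real (card \<F>)) * real ((n - 2) choose (k - 2))"
    by (simp only: power2_eq_square mult_ac)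
  moreover have "0 < real n * (real n - 1) / (real k * (real k - 1)) * real (card \<F>)" if "card \<F> \<noteq> 0"
    using assms(1) n that by simp
  ultimately have "real (card \<F>) \<le> real ((n - 2) choose (k - 2))" if "card \<F> \<noteq> 0"
    using that by (blast intro: mult_left_le_imp_le)
  then show ?thesis by (cases "card \<F> = 0") simp_all
qed

end
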